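(* Let $a,b$ be positive integers, let $P=[a]\times[b]$ (with $[n]=\{1,\dots,n\}$ and componentwise order), let $\mathbb{K}$ be a field of characteristic zero and $C\in\mathbb{K}$ a generic constant. For a (generic) labeling $g\in\mathbb{K}^P$, the Stanley--Thomas words satisfy $\operatorname{ST}_{\operatorname{BAR}(g)}(i)=\operatorname{ST}_g(i-1)$ for $2\leq i\leq a+b$ and $\operatorname{ST}_{\operatorname{BAR}(g)}(1)=\operatorname{ST}_g(a+b)$.
   Context: $\mathbb{K}^P$ is the set of labelings $g:P\to\mathbb{K}$; all maps below are birational (rational) maps, defined for generic labelings. In $P=[a]\times[b]$, $(i,j)$ is covered exactly by $(i+1,j)$ and $(i,j+1)$ (when these lie in $P$). Define: $(\Theta f)(x)=C/f(x)$; $(\nabla f)(x)=f(x)/\sum_{y\lessdot x}f(y)$, where the empty sum (for $x$ minimal) is replaced by $1$; $(\Delta^{-1}f)(x)=\sum f(y_1)f(y_2)\cdots f(y_k)$ over all saturated chains $x=y_1\lessdot y_2\lessdot\cdots\lessdot y_k$ with $y_k$ maximal in $P$, equivalently $(\Delta^{-1}f)(x)=f(x)\sum_{y\gtrdot x}(\Delta^{-1}f)(y)$ with the empty sum equal to $1$. Birational antichain rowmotion is $\operatorname{BAR}=\nabla\circ\Theta\circ\Delta^{-1}$. The Stanley--Thomas word of $g$ is the $(a+b)$-tuple with $\operatorname{ST}_g(i)=g(i,1)g(i,2)\cdots g(i,b)$ for $1\le i\le a$ and $\operatorname{ST}_g(i)=C/\big(g(1,i-a)g(2,i-a)\cdots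 g(a,i-a)\big)$ for $a+1\le i\le a+b$. *)

theory Defs
  imports Complex_Main "HOL-Library.Product_Order"
begin

text \<open>
  A labeling of a finite poset \<open>P\<close> (a subset of an order type) by a field is a function on the
  carrier type; only its values on \<open>P\<close> matter.
\<close>

definition covered_by :: "'p::order set \<Rightarrow> 'p \<Rightarrow> 'p \<Rightarrow> bool" where
  "covered_by P x y \<longleftrightarrow> x \<in> P \<and> y \<in> P \<and> x < y \<and> \<not> (\<exists>z\<in>P. x < z \<and> z < y)"

definition maximal_in :: "'p::order set \<Rightarrow> 'p \<Rightarrow> bool" where
  "maximal_in P x \<longleftrightarrow> x \<in> P \<and> \<not> (\<exists>y\<in>P. x < y)"

definition minimal_in :: "'p::order set \<Rightarrow> 'p \<Rightarrow> bool" where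
  "minimal_in P x \<longleftrightarrow> x \<in> P \<and> \<not> (\<exists>y\<in>P. y < x)"

text \<open>Saturated chains from \<open>x\<close> up to a maximal element, as lists in increasing order.\<close>

definition chains_up :: "'p::order set \<Rightarrow> 'p \<Rightarrow> 'p list set" where
  "chains_up P x = {ys. ys \<noteq> [] \<and> set ys \<subseteq> P \<and> hd ys = x \<and>
                        successively (covered_by P) ys \<and> maximal_in P (last ys)}"

text \<open>
  The rational maps are rendered as total functions (with \<open>x / 0 = 0\<close>); each comes with a
  predicate saying that no denominator vanishes on \<open>P\<close>. \<open>Delta_inv\<close> is polynomial, hence
  defined everywhere.
\<close>

definition Theta :: "'k::field \<Rightarrow> ('p \<Rightarrow> 'k) \<Rightarrow> 'p \<Rightarrow> 'k" where
  "Theta C f x = C / f x"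

definition Theta_defined :: "'p set \<Rightarrow> ('p \<Rightarrow> 'k::field) \<Rightarrow> bool" where
  "Theta_defined P f \<longleftrightarrow> (\<forall>x\<in>P. f x \<noteq> 0)"

definition nabla_denom :: "'p::order set \<Rightarrow> ('p \<Rightarrow> 'k::field) \<Rightarrow> 'p \<Rightarrow> 'k" where
  "nabla_denom P f x = (if minimal_in P x then 1 else (\<Sum>y | covered_by P y x. f y))"

definition nabla :: "'p::order set \<Rightarrow> ('p \<Rightarrow> 'k::field) \<Rightarrow> 'p \<Rightarrow> 'k" where
  "nabla P f x = f x / nabla_denom P f x"

definition nabla_defined :: "'p::order set \<Rightarrow> ('p \<Rightarrow> 'k::field) \<Rightarrow> bool" where
  "nabla_defined P f \<longleftrightarrow> (\<forall>x\<in>P. nabla_denom P f x \<noteq> 0)"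

definition Delta_inv :: "'p::order set \<Rightarrow> ('p \<Rightarrow> 'k::field) \<Rightarrow> 'p \<Rightarrow> 'k" where
  "Delta_inv P f x = (\<Sum>ys\<in>chains_up P x. prod_list (map f ys))"

definition BAR :: "'p::order set \<Rightarrow> 'k::field \<Rightarrow> ('p \<Rightarrow> 'k) \<Rightarrow> 'p \<Rightarrow> 'k" where
  "BAR P C = nabla P \<circ> Theta C \<circ> Delta_inv P"

definition BAR_defined :: "'p::order set \<Rightarrow> 'k::field \<Rightarrow> ('p \<Rightarrow> 'k) \<Rightarrow> bool" where
  "BAR_defined P C g \<longleftrightarrow>
     Theta_defined P (Delta_inv P g) \<and> nabla_defined P (Theta C (Delta_inv P g))"

text \<open>The order on pairs is the componentwise one of \<^theory>\<open>HOL-Library.Product_Order\<close>.\<close>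

definition rect :: "nat \<Rightarrow> nat \<Rightarrow> (nat \<times> nat) set" where
  "rect a b = {1..a} \<times> {1..b}"

text \<open>Only the entries with index in \<open>{1..a+b}\<close> of the Stanley--Thomas word are meaningful.\<close>

definition ST :: "nat \<Rightarrow> nat \<Rightarrow> 'k::field \<Rightarrow> (nat \<times> nat \<Rightarrow> 'k) \<Rightarrow> nat \<Rightarrow> 'k" where
  "ST a b C g i = (if i \<le> a then (\<Prod>j=1..b. g (i, j)) else C / (\<Prod>k=1..a. g (k, i - a)))"

definition ST_defined :: "nat \<Rightarrow> nat \<Rightarrow> (nat \<times> nat \<Rightarrow> 'k::field) \<Rightarrow> bool" where
  "ST_defined a b g \<longleftrightarrow> (\<forall>i\<in>{a+1..a+b}. (\<Prod>k=1..a. g (k, i - a)) \<noteq> 0)"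

text \<open>
  Polynomial functions in the coordinates \<open>g x\<close>, \<open>x \<in> P\<close>, of a labeling \<open>g\<close>. A property holds
  generically if it holds off the zero set of some nonzero polynomial. Over an infinite field
  (in particular in characteristic zero) a polynomial is nonzero iff the function it induces is
  not identically zero, which is the form used here.
\<close>

inductive_set poly_funs :: "'p set \<Rightarrow> (('p \<Rightarrow> 'k::field_char_0) \<Rightarrow> 'k) set" for P :: "'p set" where
  const: "(\<lambda>_. c) \<in> poly_funs P"
| var: "x \<in> P \<Longrightarrow> (\<lambda>g. g x) \<in> poly_funs P"
| add: "F \<in> poly_funs P \<Longrightarrow> G \<in> poly_funs P \<Longrightarrow> (\<lambda>g. F g + G g) \<in> poly_funs P"
| mult: "F \<in> poly_funs P \<Longrightarrow> G \<in> poly_funs P \<Longrightarrow> (\<lambda>g. F g * G g) \<in> poly_funs P"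

definition generically :: "'p set \<Rightarrow> (('p \<Rightarrow> 'k::field_char_0) \<Rightarrow> bool) \<Rightarrow> bool" where
  "generically P Q \<longleftrightarrow>
     (\<exists>F\<in>poly_funs P. (\<exists>g. F g \<noteq> 0) \<and> (\<forall>g. F g \<noteq> 0 \<longrightarrow> Q g))"

text \<open>
  Consistency checks: the cover relation of the rectangle, finiteness of the index set in
  \<open>Delta_inv\<close>, and the equivalent recursive description of \<open>Delta_inv\<close>.
\<close>

lemma covered_by_rect_iff:
  "covered_by (rect a b) (i, j) y \<longleftrightarrow>
     (i, j) \<in> rect a b \<and> y \<in> rect a b \<and> (y = (i + 1, j) \<or> y = (i, j + 1))"
proof (cases y)
  case (Pair k l)
  show ?thesis
  proof
    assume *: "covered_by (rect a b) (i, j) y"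
    then have le: "i \<le> k" "j \<le> l" "(i, j) \<noteq> (k, l)"
      and mem: "(i, j) \<in> rect a b" "(k, l) \<in> rect a b"
      and no: "\<And>z. z \<in> rect a b \<Longrightarrow> (i, j) < z \<Longrightarrow> \<not> z < (k, l)"
      by (auto simp: covered_by_def Pair less_le)
    show "(i, j) \<in> rect a b \<and> y \<in> rect a b \<and> (y = (i + 1, j) \<or> y = (i, j + 1))"
    proof (cases "i < k")
      case True
      then have "(i + 1, j) \<in> rect a b" using mem by (auto simp: rect_def)
      from no[OF this] have "\<not> (i + 1, j) < (k, l)" by (auto simp: less_le)
      with True le mem show ?thesis by (auto simp: less_le Pair)
    next
      case False
      then have "j < l" using le by auto
      then have "(i, j + 1) \<in> rect a b" using mem by (auto simp: rect_def)
      from no[OF this] have "\<not> (i, j + 1) < (k, l)" by (auto simp: less_le)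
      with False \<open>j < l\<close> le mem show ?thesis by (auto simp: less_le Pair)
    qed
  next
    assume "(i, j) \<in> rect a b \<and> y \<in> rect a b \<and> (y = (i + 1, j) \<or> y = (i, j + 1))"
    then show "covered_by (rect a b) (i, j) y"
      by (auto simp: covered_by_def less_le)
  qed
qed

lemma successively_covered_by_sorted:
  "successively (covered_by P) ys \<Longrightarrow> sorted_wrt (<) ys"
proof (induction ys)
  case (Cons x ys)
  then show ?case
    by (cases ys) (auto simp: covered_by_def dest: less_trans)
qed simp

lemma sorted_wrt_less_imp_distinct:
  fixes ys :: "'p::order list"
  shows "sorted_wrt (<) ys \<Longrightarrow> distinct ys"
  by (induction ys) auto

lemma finite_chains_up:
  assumes "finite P"
  shows "finite (chains_up P x)"
proof -
  have "distinct ys" if "ys \<in> chains_up P x" for ys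
    using that successively_covered_by_sorted sorted_wrt_less_imp_distinct
    unfolding chains_up_def by blast
  then have "chains_up P x \<subseteq> {ys. set ys \<subseteq> P \<and> distinct ys}"
    by (auto simp: chains_up_def)
  then show ?thesis
    using finite_subset finite_subset_distinct[OF assms] by blast
qed

lemma chains_up_rec:
  assumes "x \<in> P"
  shows "chains_up P x = (if maximal_in P x then {[x]}
           else (\<Union>y\<in>{y. covered_by P x y}. (#) x ` chains_up P y))"
proof -
  have single: "[z] \<in> chains_up P x \<longleftrightarrow> z = x \<and> maximal_in P x" for z
    using assms by (auto simp: chains_up_def)
  have cons: "z # w # ws \<in> chains_up P x \<longleftrightarrow>
      z = x \<and> covered_by P x w \<and> w # ws \<in> chains_up P w" for z w ws
    using assms by (auto simp: chains_up_def)
  have not_max: "\<not> maximal_in P x" if "covered_by P x y" for y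
    using that by (auto simp: covered_by_def maximal_in_def)
  have hd: "w = y" if "w # ws \<in> chains_up P y" for w ws y
    using that by (simp add: chains_up_def)
  have ne: "[] \<notin> chains_up P y" for y
    by (simp add: chains_up_def)
  have "ys \<in> chains_up P x \<longleftrightarrow> ys \<in> (if maximal_in P x then {[x]}
           else (\<Union>y\<in>{y. covered_by P x y}. (#) x ` chains_up P y))" for ys
  proof (cases ys)
    case Nil
    then show ?thesis by (simp add: ne image_iff)
  next
    case ys: (Cons z zs)
    show ?thesis
    proof (cases zs)
      case Nil
      then show ?thesis by (simp add: ys single image_iff ne)
    next
      case zs: (Cons w ws)
      have "(\<exists>y. covered_by P x y \<and> w # ws \<in> chains_up P y) \<longleftrightarrow>
              covered_by P x w \<and> w # ws \<in> chains_up P w"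
        using hd by blast
      with not_max show ?thesis
        by (simp add: ys zs cons image_iff) blast
    qed
  qed
  then show ?thesis by (rule set_eqI)
qed

lemma Delta_inv_rec:
  assumes "finite P" "x \<in> P"
  shows "Delta_inv P f x = f x *
           (if maximal_in P x then 1 else (\<Sum>y | covered_by P x y. Delta_inv P f y))"
proof (cases "maximal_in P x")
  case True
  then show ?thesis using assms by (simp add: Delta_inv_def chains_up_rec)
next
  case False
  have fin: "finite {y. covered_by P x y}"
    by (rule finite_subset[OF _ assms(1)]) (auto simp: covered_by_def)
  have "Delta_inv P f x =
      (\<Sum>ys\<in>(\<Union>y\<in>{y. covered_by P x y}. (#) x ` chains_up P y). prod_list (map f ys))"
    using False assms by (simp add: Delta_inv_def chains_up_rec[of x])
  also have "\<dots> = (\<Sum>y | covered_by P x y. \<Sum>ys\<in>(#) x ` chains_up P y. prod_list (map f ys))"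
    using fin finite_chains_up[OF assms(1)]
    by (intro sum.UNION_disjoint) (auto simp: chains_up_def)
  also have "\<dots> = (\<Sum>y | covered_by P x y. f x * Delta_inv P f y)"
    by (intro sum.cong refl) (simp add: Delta_inv_def sum.reindex sum_distrib_left)
  finally show ?thesis using False by (simp add: sum_distrib_left)
qed

end

theory Submission
  imports Defs
begin

text \<open>
  Put \<open>D = \<Delta>\<^sup>-\<^sup>1 g\<close> and \<open>h = BAR g\<close>. For an interior square the denominators occurring in \<open>h\<close> at the
  upper corner and in \<open>g\<close> at the lower corner are the same sum \<open>D(i+1,j) + D(i,j+1)\<close>:
  \<open>h(i+1,j+1) = D(i,j+1) D(i+1,j) / (D(i+1,j+1) (D(i+1,j) + D(i,j+1)))\<close> and
  \<open>g(i,j) = D(i,j) / (D(i+1,j) + D(i,j+1))\<close>. Hence the partial products of row \<open>i+1\<close> of \<open>h\<close>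
  telescope to those of row \<open>i\<close> of \<open>g\<close>, up to the factor \<open>D(i,n) / D(i+1,n)\<close>, which the last entry
  of row \<open>i\<close> absorbs. Columns are treated by transposition, and the first row and column of \<open>h\<close>
  are matched with the last column and row of \<open>g\<close>. All of this only needs \<open>D\<close> to have no zeros, so
  the polynomial \<open>\<Prod>\<^sub>x D(x)\<close> cuts out the exceptional set; at \<open>g = 1\<close> it counts chains.
\<close>

section \<open>\<open>Delta_inv\<close> as a polynomial in the labels\<close>

lemma sum_in_poly_funs:
  assumes "finite A" "\<And>y. y \<in> A \<Longrightarrow> F y \<in> poly_funs P"
  shows "(\<lambda>g. \<Sum>y\<in>A. F y g) \<in> poly_funs P"
  using assms
  by (induction A rule: finite_induct) (auto intro: poly_funs.const poly_funs.add)

lemma prod_in_poly_funs: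
  assumes "finite A" "\<And>y. y \<in> A \<Longrightarrow> F y \<in> poly_funs P"
  shows "(\<lambda>g. \<Prod>y\<in>A. F y g) \<in> poly_funs P"
  using assms
  by (induction A rule: finite_induct) (auto intro: poly_funs.const poly_funs.mult)

lemma prod_list_in_poly_funs:
  "set ys \<subseteq> P \<Longrightarrow> (\<lambda>g. prod_list (map g ys)) \<in> poly_funs P"
  by (induction ys) (auto intro: poly_funs.const poly_funs.mult poly_funs.var)

lemma Delta_inv_in_poly_funs:
  assumes "finite P"
  shows "(\<lambda>g. Delta_inv P g x) \<in> poly_funs P"
  unfolding Delta_inv_def
  by (intro sum_in_poly_funs finite_chains_up assms prod_list_in_poly_funs)
     (auto simp: chains_up_def)

lemma Delta_inv_one: "Delta_inv P (\<lambda>_. 1) x = of_nat (card (chains_up P x))"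
proof -
  have "prod_list (map (\<lambda>_. 1) ys) = (1 :: 'a)" for ys :: "'b list"
    by (induction ys) auto
  then show ?thesis
    by (simp add: Delta_inv_def)
qed

section \<open>Extremal elements, covers and chains of the rectangle\<close>

lemma finite_rect [simp]: "finite (rect a b)"
  by (simp add: rect_def)

lemma mem_rect_iff [simp]: "(i, j) \<in> rect a b \<longleftrightarrow> 1 \<le> i \<and> i \<le> a \<and> 1 \<le> j \<and> j \<le> b"
  by (auto simp: rect_def)

lemma maximal_in_rect_iff:
  "maximal_in (rect a b) (i, j) \<longleftrightarrow> (i, j) \<in> rect a b \<and> i = a \<and> j = b"
proof
  assume *: "maximal_in (rect a b) (i, j)"
  then have mem: "(i, j) \<in> rect a b" and "\<not> (i, j) < (a, b)"
    by (auto simp: maximal_in_def)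
  then show "(i, j) \<in> rect a b \<and> i = a \<and> j = b"
    by (auto simp: less_le)
qed (auto simp: maximal_in_def less_le)

lemma minimal_in_rect_iff:
  "minimal_in (rect a b) (i, j) \<longleftrightarrow> (i, j) \<in> rect a b \<and> i = 1 \<and> j = 1"
proof
  assume *: "minimal_in (rect a b) (i, j)"
  then have mem: "(i, j) \<in> rect a b" and "\<not> (1, 1) < (i, j)"
    by (auto simp: minimal_in_def)
  then show "(i, j) \<in> rect a b \<and> i = 1 \<and> j = 1"
    by (auto simp: less_le)
qed (auto simp: minimal_in_def less_le)

lemma sum_covers_rect:
  assumes "(i, j) \<in> rect a b"
  shows "(\<Sum>y | covered_by (rect a b) (i, j) y. F y) =
           (if i < a then F (i + 1, j) else 0) + (if j < b then F (i, j + 1) else (0 :: 'k::field))"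
proof -
  have "{y. covered_by (rect a b) (i, j) y} =
          (if i < a then {(i + 1, j)} else {}) \<union> (if j < b then {(i, j + 1)} else {})"
    using assms by (auto simp: covered_by_rect_iff split: if_splits)
  then show ?thesis by simp
qed

lemma sum_covered_rect:
  assumes "(i, j) \<in> rect a b"
  shows "(\<Sum>y | covered_by (rect a b) y (i, j). F y) =
           (if 1 < i then F (i - 1, j) else 0) + (if 1 < j then F (i, j - 1) else (0 :: 'k::field))"
proof -
  have "{y. covered_by (rect a b) y (i, j)} =
          (if 1 < i then {(i - 1, j)} else {}) \<union> (if 1 < j then {(i, j - 1)} else {})"
    using assms by (auto simp: covered_by_rect_iff split: if_splits)
  then show ?thesis using assms by auto
qed

text \<open>A step to an upper cover lowers the distance \<open>(a - i) + (b - j)\<close> to the top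
  corner, so climbing ends there.\<close>

lemma chains_up_rect_nonempty:
  "(i, j) \<in> rect a b \<Longrightarrow> chains_up (rect a b) (i, j) \<noteq> {}"
proof (induction "(a - i) + (b - j)" arbitrary: i j rule: less_induct)
  case less
  show ?case
  proof (cases "maximal_in (rect a b) (i, j)")
    case True
    then show ?thesis using less.prems by (simp add: chains_up_rec)
  next
    case False
    obtain k l where kl: "covered_by (rect a b) (i, j) (k, l)" "(a - k) + (b - l) < (a - i) + (b - j)"
    proof (cases "i < a")
      case True
      then show ?thesis using less.prems by (intro that[of "i + 1" j]) (auto simp: covered_by_rect_iff)
    next
      case a: False
      with False have "j < b" using less.prems by (auto simp: maximal_in_rect_iff)
      then show ?thesis using less.prems by (intro that[of i "j + 1"]) (auto simp: covered_by_rect_iff)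
    qed
    then have "chains_up (rect a b) (k, l) \<noteq> {}"
      using less.hyps by (auto simp: covered_by_def)
    then show ?thesis
      using kl(1) False less.prems by (auto simp: chains_up_rec[of "(i, j)"])
  qed
qed

lemma Delta_inv_rect:
  assumes "(i, j) \<in> rect a b"
  shows "Delta_inv (rect a b) g (i, j) = g (i, j) *
           (if i = a \<and> j = b then 1
            else (if i < a then Delta_inv (rect a b) g (i + 1, j) else 0) +
                 (if j < b then Delta_inv (rect a b) g (i, j + 1) else 0))"
  unfolding Delta_inv_rec[OF finite_rect assms] sum_covers_rect[OF assms] maximal_in_rect_iff
  using assms by simp

lemma nabla_denom_rect:
  assumes "(i, j) \<in> rect a b"
  shows "nabla_denom (rect a b) f (i, j) =
           (if i = 1 \<and> j = 1 then 1
            else (if 1 < i then f (i - 1, j) else 0) + (if 1 < j then f (i, j - 1) else 0))"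
  unfolding nabla_denom_def sum_covered_rect[OF assms] minimal_in_rect_iff
  using assms by simp

text \<open>The equations relating \<open>g\<close>, \<open>D = \<Delta>\<^sup>-\<^sup>1 g\<close> and \<open>h = BAR g\<close>, in a form invariant under transposition.\<close>

locale rowmotion_rect =
  fixes a b :: nat and C :: "'k::field" and g D h :: "nat \<Rightarrow> nat \<Rightarrow> 'k"
  assumes ab: "1 \<le> a" "1 \<le> b"
    and C_nonzero: "C \<noteq> 0"
    and D_nonzero: "\<lbrakk>1 \<le> i; i \<le> a; 1 \<le> j; j \<le> b\<rbrakk> \<Longrightarrow> D i j \<noteq> 0"
    and D_rec: "\<lbrakk>1 \<le> i; i \<le> a; 1 \<le> j; j \<le> b\<rbrakk> \<Longrightarrow> D i j = g i j *
          (if i = a \<and> j = b then 1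
           else (if i < a then D (i + 1) j else 0) + (if j < b then D i (j + 1) else 0))"
    and h_eq: "\<lbrakk>1 \<le> i; i \<le> a; 1 \<le> j; j \<le> b\<rbrakk> \<Longrightarrow> h i j = C / D i j /
          (if i = 1 \<and> j = 1 then 1
           else (if 1 < i then C / D (i - 1) j else 0) + (if 1 < j then C / D i (j - 1) else 0))"
begin

section \<open>Row and column products of \<open>h\<close> against those of \<open>g\<close>\<close>

lemma transpose: "rowmotion_rect b a C (\<lambda>i j. g j i) (\<lambda>i j. D j i) (\<lambda>i j. h j i)"
  \<comment> \<open>Swapping the coordinates only exchanges the two summands in \<open>D_rec\<close>
    and in \<open>h_eq\<close>.\<close>
  by unfold_locales
    (use ab C_nonzero D_nonzero in \<open>simp_all add: D_rec[symmetric] h_eq\<close>,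
     auto simp: D_rec add.commute)

text \<open>The \<open>g\<close>-product stops before \<open>n\<close>: for \<open>n < b\<close> the
  sum in the denominator of \<open>g i n\<close> first appears with
  \<open>h (i + 1) (n + 1)\<close>, so the induction step brings in exactly these two
  entries.\<close>

lemma prod_row_partial:
  assumes i: "1 \<le> i" "i < a" and n: "1 \<le> n" "n \<le> b"
  shows "(\<Prod>j=1..n. h (i + 1) j) = (\<Prod>j=1..<n. g i j) * D i n / D (i + 1) n"
  using n
proof (induction n rule: nat_induct_at_least)
  case base
  \<comment> \<open>\<open>(i, 1)\<close> is the only lower cover of \<open>(i + 1, 1)\<close>, so
    \<open>h (i + 1) 1 = D i 1 / D (i + 1) 1\<close>; the \<open>g\<close>-product is empty.\<close>
  show ?case using i C_nonzero ab D_nonzero[of i 1] D_nonzero[of "i + 1" 1]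
    by (simp add: h_eq field_simps)
next
  case (Suc n)
  have nz: "D i n \<noteq> 0" "D (i + 1) n \<noteq> 0" "D i (n + 1) \<noteq> 0" "D (i + 1) (n + 1) \<noteq> 0"
    using i Suc.hyps Suc.prems by (simp_all add: D_nonzero)
  have D: "D i n = g i n * (D (i + 1) n + D i (n + 1))"
    using D_rec[of i n] i Suc.hyps Suc.prems by simp
  \<comment> \<open>The sum is a factor of \<open>D i n\<close>.\<close>
  with nz have S: "D (i + 1) n + D i (n + 1) \<noteq> 0" by auto
  have "h (i + 1) (n + 1) = C / D (i + 1) (n + 1) / (C / D i (n + 1) + C / D (i + 1) n)"
    using h_eq[of "i + 1" "n + 1"] i Suc.hyps Suc.prems by simp
  also have "C / D i (n + 1) + C / D (i + 1) n =
      C * (D (i + 1) n + D i (n + 1)) / (D i (n + 1) * D (i + 1) n)"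
    using nz by (simp add: field_simps)
  also have "C / D (i + 1) (n + 1) / \<dots> =
      D i (n + 1) * D (i + 1) n / (D (i + 1) (n + 1) * (D (i + 1) n + D i (n + 1)))"
    using C_nonzero by simp
  finally have h: "h (i + 1) (n + 1) = \<dots>" .
  have g: "g i n = D i n / (D (i + 1) n + D i (n + 1))"
    using S by (subst D) simp
  have "(\<Prod>j=1..Suc n. h (i + 1) j) = (\<Prod>j=1..n. h (i + 1) j) * h (i + 1) (n + 1)"
    by simp
  also have "\<dots> = (\<Prod>j=1..<n. g i j) * D i n / D (i + 1) n *
      (D i (n + 1) * D (i + 1) n / (D (i + 1) (n + 1) * (D (i + 1) n + D i (n + 1))))"
    using Suc by (simp only: h)
  also have "\<dots> = (\<Prod>j=1..<n. g i j) * g i n * D i (n + 1) / D (i + 1) (n + 1)"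
    using nz by (simp add: g mult_ac)
  finally show ?case
    using Suc.hyps by (simp add: prod.atLeastLessThan_Suc)
qed

lemma prod_row_Suc:
  assumes "1 \<le> i" "i < a"
  shows "(\<Prod>j=1..b. h (i + 1) j) = (\<Prod>j=1..b. g i j)"
proof -
  have "{1..b} = insert b {1..<b}"
    using ab by auto
  then have "(\<Prod>j=1..b. g i j) = (\<Prod>j=1..<b. g i j) * g i b"
    by simp
  \<comment> \<open>\<open>(i, b)\<close> has the single upper cover \<open>(i + 1, b)\<close>, so
    the leftover ratio \<open>D i b / D (i + 1) b\<close> is \<open>g i b\<close>.\<close>
  moreover have "D i b = g i b * D (i + 1) b"
    using D_rec[of i b] assms ab by simp
  moreover have "D (i + 1) b \<noteq> 0"
    using assms ab by (intro D_nonzero) auto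
  ultimately show ?thesis
    using prod_row_partial[OF assms, of b] ab by simp
qed

text \<open>For \<open>j > 1\<close> the single lower cover gives
  \<open>h 1 j = D 1 (j - 1) / D 1 j\<close>, so the product telescopes, starting from
  \<open>h 1 1 = C / D 1 1\<close>.\<close>

lemma prod_first_row_partial:
  assumes "1 \<le> n" "n \<le> b"
  shows "(\<Prod>j=1..n. h 1 j) = C / D 1 n"
  using assms
proof (induction n rule: nat_induct_at_least)
  case base
  then show ?case using ab h_eq[of 1 1] by simp
next
  case (Suc n)
  then have "D 1 n \<noteq> 0"
    using ab by (intro D_nonzero) auto
  then show ?case
    using Suc ab C_nonzero h_eq[of 1 "Suc n"] by simp
qed

text \<open>In the last column the only step up stays in that column, so \<open>D_rec\<close>
  unrolls to a single monomial.\<close>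

lemma prod_last_column_partial:
  assumes "m \<le> a" "1 \<le> m"
  shows "(\<Prod>k=m..a. g k b) = D m b"
  using assms
proof (induction m rule: inc_induct)
  case base
  then show ?case using ab D_rec[of a b] by simp
next
  case (step m)
  then show ?case
    using ab D_rec[of m b] by (simp add: prod.atLeast_Suc_atMost[of m])
qed

text \<open>Both sides equal \<open>C / D 1 b\<close>, read off at the corner shared by the first
  row and the last column.\<close>

lemma prod_first_row: "(\<Prod>j=1..b. h 1 j) = C / (\<Prod>k=1..a. g k b)"
  using prod_first_row_partial[of b] prod_last_column_partial[of 1] ab by simp

section \<open>Nonvanishing of labels and denominators\<close>

lemma g_nonzero: "\<lbrakk>1 \<le> i; i \<le> a; 1 \<le> j; j \<le> b\<rbrakk> \<Longrightarrow> g i j \<noteq> 0"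
  using D_rec[of i j] D_nonzero[of i j] by auto

lemma prod_column_nonzero: "\<lbrakk>1 \<le> j; j \<le> b\<rbrakk> \<Longrightarrow> (\<Prod>k=1..a. g k j) \<noteq> 0"
  using g_nonzero by simp

text \<open>Off the first row and column this is a nonzero multiple of
  \<open>D i (j - 1) + D (i - 1) j\<close>, a factor of \<open>D (i - 1) (j - 1)\<close>; elsewhere
  it is 1 or a single quotient.\<close>

lemma denom_nonzero:
  assumes "1 \<le> i" "i \<le> a" "1 \<le> j" "j \<le> b"
  shows "(if i = 1 \<and> j = 1 then 1
          else (if 1 < i then C / D (i - 1) j else 0) + (if 1 < j then C / D i (j - 1) else 0)) \<noteq> 0"
proof (cases "1 < i \<and> 1 < j")
  case True
  define k l where kl_def: "k = i - 1" "l = j - 1"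
  have ij: "i = k + 1" "j = l + 1" "1 \<le> k" "1 \<le> l"
    using True by (auto simp: kl_def)
  have nz: "D k l \<noteq> 0" "D (k + 1) l \<noteq> 0" "D k (l + 1) \<noteq> 0"
    using ij assms by (simp_all add: D_nonzero)
  then have "D (k + 1) l + D k (l + 1) \<noteq> 0"
    using D_rec[of k l] ij assms by auto
  moreover have "C / D k (l + 1) + C / D (k + 1) l =
      C * (D (k + 1) l + D k (l + 1)) / (D k (l + 1) * D (k + 1) l)"
    using nz by (simp add: field_simps)
  ultimately show ?thesis
    using ij nz C_nonzero by simp
next
  case False
  have "1 < i \<Longrightarrow> D (i - 1) j \<noteq> 0" "1 < j \<Longrightarrow> D i (j - 1) \<noteq> 0"
    using assms by (simp_all add: D_nonzero)
  moreover have "i = 1 \<or> j = 1"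
    using assms False by linarith
  ultimately show ?thesis
    using assms C_nonzero by (elim disjE) simp_all
qed

lemma h_nonzero: "\<lbrakk>1 \<le> i; i \<le> a; 1 \<le> j; j \<le> b\<rbrakk> \<Longrightarrow> h i j \<noteq> 0"
  unfolding h_eq using denom_nonzero[of i j] D_nonzero[of i j] C_nonzero by simp

end

section \<open>Genericity and the cyclic shift of the word\<close>

theorem theorem3p10:
  fixes a b :: nat and C :: "'k::field_char_0"
  assumes "a \<ge> 1" and "b \<ge> 1" and "C \<noteq> 0"
  shows "generically (rect a b) (\<lambda>g.
           BAR_defined (rect a b) C g \<and>
           ST_defined a b g \<and> ST_defined a b (BAR (rect a b) C g) \<and>
           (\<forall>i\<in>{2..a+b}. ST a b C (BAR (rect a b) C g) i = ST a b C g (i - 1)) \<and>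
           ST a b C (BAR (rect a b) C g) 1 = ST a b C g (a + b))"
proof -
  let ?P = "rect a b"
  let ?F = "\<lambda>g :: nat \<times> nat \<Rightarrow> 'k. \<Prod>x\<in>?P. Delta_inv ?P g x"
  have poly: "?F \<in> poly_funs ?P"
    by (intro prod_in_poly_funs Delta_inv_in_poly_funs finite_rect)
  have "card (chains_up ?P x) \<noteq> 0" if "x \<in> ?P" for x
    using that chains_up_rect_nonempty finite_chains_up[OF finite_rect]
    by (cases x) (simp add: card_eq_0_iff)
  \<comment> \<open>Characteristic zero keeps the positive chain counts nonzero in the
    field.\<close>
  then have nonzero: "?F (\<lambda>_. 1) \<noteq> 0"
    by (simp add: Delta_inv_one)
  have main: "BAR_defined ?P C g \<and>
      ST_defined a b g \<and> ST_defined a b (BAR ?P C g) \<and>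
      (\<forall>i\<in>{2..a+b}. ST a b C (BAR ?P C g) i = ST a b C g (i - 1)) \<and>
      ST a b C (BAR ?P C g) 1 = ST a b C g (a + b)"
    if "?F g \<noteq> 0" for g
  proof -
    let ?D = "Delta_inv ?P g" and ?h = "BAR ?P C g"
    have D_nonzero: "?D x \<noteq> 0" if "x \<in> ?P" for x
      using \<open>?F g \<noteq> 0\<close> that by simp
    interpret R: rowmotion_rect a b C "\<lambda>i j. g (i, j)" "\<lambda>i j. ?D (i, j)" "\<lambda>i j. ?h (i, j)"
    proof
      show "?D (i, j) = g (i, j) * (if i = a \<and> j = b then 1
          else (if i < a then ?D (i + 1, j) else 0) + (if j < b then ?D (i, j + 1) else 0))"
        if "1 \<le> i" "i \<le> a" "1 \<le> j" "j \<le> b" for i j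
        using that by (intro Delta_inv_rect) simp
      show "?h (i, j) = C / ?D (i, j) / (if i = 1 \<and> j = 1 then 1
          else (if 1 < i then C / ?D (i - 1, j) else 0) + (if 1 < j then C / ?D (i, j - 1) else 0))"
        if "1 \<le> i" "i \<le> a" "1 \<le> j" "j \<le> b" for i j
        using that by (simp add: BAR_def nabla_def nabla_denom_rect Theta_def)
    qed (use assms D_nonzero in auto)
    interpret T: rowmotion_rect b a C "\<lambda>i j. g (j, i)" "\<lambda>i j. ?D (j, i)" "\<lambda>i j. ?h (j, i)"
      by (rule R.transpose)
    have BAR: "BAR_defined ?P C g"
      unfolding BAR_defined_def Theta_defined_def nabla_defined_def
    proof (intro conjI ballI)
      show "nabla_denom ?P (Theta C ?D) x \<noteq> 0" if "x \<in> ?P" for x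
      proof (cases x)
        case (Pair i j)
        then show ?thesis
          using that R.denom_nonzero[of i j] nabla_denom_rect[of i j a b "Theta C ?D"]
          by (simp only: Theta_def mem_rect_iff) simp
      qed
    qed (rule D_nonzero)
    have "ST_defined a b g"
      unfolding ST_defined_def by (intro ballI R.prod_column_nonzero) auto
    moreover have "ST_defined a b ?h"
      unfolding ST_defined_def
      by (intro ballI) (use R.h_nonzero in \<open>auto simp: Suc_le_eq\<close>)
    moreover have "ST a b C ?h i = ST a b C g (i - 1)" if i: "i \<in> {2..a+b}" for i
    proof -
      \<comment> \<open>Rows of \<open>h\<close> are matched with rows of \<open>g\<close>, then at
        \<open>i = a + 1\<close> the first column with the last row, then columns with
        columns.\<close>
      consider "i \<le> a" | "i = a + 1" | "a + 2 \<le> i"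
        by linarith
      then show ?thesis
      proof cases
        case 1
        moreover from this have "i - 1 \<le> a" by simp
        ultimately show ?thesis using R.prod_row_Suc[of "i - 1"] i by (simp add: ST_def)
      next
        case 2
        \<comment> \<open>Column 1 of \<open>h\<close> has product \<open>C\<close> over that of row
          \<open>a\<close> of \<open>g\<close>; the quotient in \<open>ST\<close> inverts this back
          to the row product.\<close>
        have "(\<Prod>j=1..b. g (a, j)) \<noteq> 0"
          using T.prod_column_nonzero[of a] assms by simp
        then show ?thesis using T.prod_first_row 2 assms by (simp add: ST_def)
      next
        case 3
        \<comment> \<open>Entry \<open>i\<close> reads column \<open>i - a = k + 1\<close> of
          \<open>h\<close>, entry \<open>i - 1\<close> column \<open>k\<close> of
          \<open>g\<close>.\<close>
        then obtain k where k: "i = a + k + 1" "1 \<le> k"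
          by (intro that[of "i - a - 1"]) auto
        then show ?thesis
          using T.prod_row_Suc[of k] i by (simp add: ST_def)
      qed
    qed
    moreover have "ST a b C ?h 1 = ST a b C g (a + b)"
      using R.prod_first_row assms by (simp add: ST_def)
    ultimately show ?thesis using BAR by blast
  qed
  show ?thesis
    unfolding generically_def
  proof (rule bexI[OF _ poly], rule conjI)
    show "\<exists>g. ?F g \<noteq> 0"
      using nonzero by (rule exI[of _ "\<lambda>_. 1"])
  qed (rule allI, rule impI, rule main)
qed

end
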